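(* Let $\mu$ be a weakly compact cardinal and let $\lambda\ge\mu$ be a regular cardinal. If $(X,<)$ is a linearly ordered set with $|X|=\lambda$, then $X$ has a subset which is $\lambda$-full in $X$ and whose order type is $\mu$ or the reverse of $\mu$, or $X$ has a subset whose order type is $\lambda$ or the reverse of $\lambda$.
   Context: For a linearly ordered set $X$ with $|X|=\lambda$, $Y\subseteq X$ and $y_1<y_2$ in $Y$, write $(y_1,y_2)_X=\{x\in X: y_1<x<y_2\}$. $Y$ is $\lambda$-full in $X$ on the right if for every $y\in Y$, $\left|\bigcup_{y<y'\in Y}(y,y')_X\right|=\lambda$; $Y$ is $\lambda$-full in $X$ on the left if for every $y\in Y$, $\left|\bigcup_{Y\ni y'<y}(y',y)_X\right|=\lambda$. "$\lambda$-full" means $\lambda$-full on the right or on the left. *)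

theory Defs
  imports Main "HOL-Library.Ramsey"
begin

unbundle cardinal_syntax

text \<open>
  Cardinals are represented, as in the library, by initial well-orders
  (\<^const>\<open>card_order_on\<close>). A linear order is a reflexive relation \<open>r\<close> on
  a carrier \<open>X\<close>, so that \<open>x < y\<close> reads \<open>(x, y) \<in> r \<and> x \<noteq> y\<close>.
\<close>

definition partition_arrow_2_2 :: "'m rel \<Rightarrow> bool" where
  "partition_arrow_2_2 \<mu> \<longleftrightarrow>
     (\<forall>f \<in> [Field \<mu>]\<^bsup>2\<^esup> \<rightarrow> {..<2::nat}.
        \<exists>H \<subseteq> Field \<mu>. |H| =o \<mu> \<and> (\<exists>i<2. f ` [H]\<^bsup>2\<^esup> \<subseteq> {i}))"

text \<open>A weakly compact cardinal is an uncountable cardinal with \<open>\<mu> \<rightarrow> (\<mu>)\<^sup>2\<^sub>2\<close>.\<close>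

definition weakly_compact :: "'m rel \<Rightarrow> bool" where
  "weakly_compact \<mu> \<longleftrightarrow> Card_order \<mu> \<and> natLeq <o \<mu> \<and> partition_arrow_2_2 \<mu>"

definition open_interval :: "'a set \<Rightarrow> 'a rel \<Rightarrow> 'a \<Rightarrow> 'a \<Rightarrow> 'a set" where
  "open_interval X r y1 y2 = {x \<in> X. (y1, x) \<in> r \<and> y1 \<noteq> x \<and> (x, y2) \<in> r \<and> x \<noteq> y2}"

definition full_right :: "'l rel \<Rightarrow> 'a set \<Rightarrow> 'a rel \<Rightarrow> 'a set \<Rightarrow> bool" where
  "full_right \<kappa> X r Y \<longleftrightarrow>
     (\<forall>y\<in>Y. |\<Union>y' \<in> {y' \<in> Y. (y, y') \<in> r \<and> y \<noteq> y'}. open_interval X r y y'| =o \<kappa>)"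

definition full_left :: "'l rel \<Rightarrow> 'a set \<Rightarrow> 'a rel \<Rightarrow> 'a set \<Rightarrow> bool" where
  "full_left \<kappa> X r Y \<longleftrightarrow>
     (\<forall>y\<in>Y. |\<Union>y' \<in> {y' \<in> Y. (y', y) \<in> r \<and> y' \<noteq> y}. open_interval X r y' y| =o \<kappa>)"

definition full :: "'l rel \<Rightarrow> 'a set \<Rightarrow> 'a rel \<Rightarrow> 'a set \<Rightarrow> bool" where
  "full \<kappa> X r Y \<longleftrightarrow> full_right \<kappa> X r Y \<or> full_left \<kappa> X r Y"

text \<open>
  For a cardinal \<open>\<kappa>\<close>, which is itself a well-order of type \<open>\<kappa>\<close>, the relation \<open>=o\<close>
  is isomorphism of well-orders; it is used here with \<open>Y\<close> in the order induced by \<open>r\<close>.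
\<close>

definition has_order_type :: "'a rel \<Rightarrow> 'a set \<Rightarrow> 'k rel \<Rightarrow> bool" where
  "has_order_type r Y \<kappa> \<longleftrightarrow> Restr r Y =o \<kappa>"

definition has_reverse_order_type :: "'a rel \<Rightarrow> 'a set \<Rightarrow> 'k rel \<Rightarrow> bool" where
  "has_reverse_order_type r Y \<kappa> \<longleftrightarrow> (Restr r Y)\<inverse> =o \<kappa>"

end

(*
  If X has no subset of type \<kappa> or its reverse, then every z has fewer than \<kappa> points x
  such that the interval between z and x has size less than \<kappa>: such points form a convex
  set, and were \<kappa> many of them on one side of z, a subset of that side of type \<kappa> (or its
  reverse) would arise as the set of records of a well-order. Hence a maximal set Z of points
  that are pairwise separated by \<kappa> points of X has size \<kappa>, by regularity. Weak compactness
  gives a subset of Z of type \<mu> or its reverse, and any such subset is full.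
*)

theory Submission
  imports Defs
begin

section \<open>Sizes below a cardinal and suborders of full size\<close>

lemma card_of_subset_cases:
  assumes "|X| =o \<kappa>" and "A \<subseteq> X"
  shows "|A| =o \<kappa> \<or> |A| <o \<kappa>"
  using ordLeq_ordIso_trans[OF card_of_mono1[OF assms(2)] assms(1)]
  by (auto simp: ordLeq_iff_ordLess_or_ordIso)

lemma finite_ordLess_Card_order:
  assumes "Card_order \<kappa>" and "\<not> finite (Field \<kappa>)" and "finite A"
  shows "|A| <o \<kappa>"
  using finite_ordLess_infinite[OF card_of_Well_order, of \<kappa> A] assms
  by (simp add: card_order_on_def Field_card_of)

text \<open>An initial well-order is least among the well-orders of its size: if \<kappa> embedded
  in \<open>p\<close>, then the cardinality of \<kappa> would be at most that of
  \<open>Field p\<close>.\<close>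

lemma ordLess_of_Field_ordLess:
  assumes "Card_order \<kappa>" and "Well_order p" and "|Field p| <o \<kappa>"
  shows "p <o \<kappa>"
proof (rule ccontr)
  assume "\<not> p <o \<kappa>"
  then have "\<kappa> \<le>o p"
    using assms by (auto simp: card_order_on_def not_ordLess_iff_ordLeq)
  then have "|Field \<kappa>| \<le>o |Field p|"
    by (rule card_of_mono2)
  then have "\<kappa> \<le>o |Field p|"
    using assms(1) card_of_Field_ordIso ordIso_ordLeq_trans ordIso_symmetric by blast
  then show False
    using assms(3) not_ordLess_ordLeq by blast
qed

text \<open>The type of \<open>Restr w Y\<close> is at least \<kappa>, because \<open>|Y|\<close> is
  the least well-order on \<open>Y\<close>. It is at most \<kappa>, because each proper initial
  segment has its field inside a proper initial segment of the initial order \<open>w\<close> and is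
  therefore shorter than \<open>w\<close>.\<close>

lemma Restr_Card_order_ordIso:
  assumes "Card_order \<kappa>" and "w =o \<kappa>" and "Y \<subseteq> Field w" and "|Y| =o \<kappa>"
  shows "Restr w Y =o \<kappa>"
proof -
  have w: "Card_order w"
    using assms Card_order_ordIso by blast
  then have W: "Well_order w" and R: "Well_order (Restr w Y)"
    by (auto simp: card_order_on_def intro: Well_order_Restr)
  have "well_order_on Y (Restr w Y)"
    using W assms(3) well_order_on_Restr by blast
  then have ge: "|Y| \<le>o Restr w Y" and fld: "Field (Restr w Y) = Y"
    using card_of_least well_order_on_Field by blast+
  have "Restr (Restr w Y) (underS (Restr w Y) a) <o w" if "a \<in> Y" for a
  proof (rule ordLess_of_Field_ordLess[OF w])
    show "Well_order (Restr (Restr w Y) (underS (Restr w Y) a))"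
      using R by (rule Well_order_Restr)
    have "Field (Restr (Restr w Y) (underS (Restr w Y) a)) \<subseteq> underS w a"
      by (auto simp: Field_def underS_def)
    moreover have "|underS w a| <o w"
      using card_of_underS[OF w] that assms(3) by (metis subsetD)
    ultimately show "|Field (Restr (Restr w Y) (underS (Restr w Y) a))| <o w"
      by (rule ordLeq_ordLess_trans[OF card_of_mono1])
  qed
  then have "Restr w Y \<le>o w"
    using ordLeq_iff_ordLess_Restr[OF R W] fld by simp
  then show ?thesis
    using ge assms by (meson ordIso_iff_ordLeq ordLeq_transitive)
qed

section \<open>Reversal of the order and agreement with a well-order\<close>

lemma has_reverse_order_type_converse:
  "has_reverse_order_type r Y \<kappa> \<longleftrightarrow> has_order_type (r\<inverse>) Y \<kappa>"
  by (simp add: has_order_type_def has_reverse_order_type_def converse_Int converse_Times)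

lemma open_interval_converse: "open_interval X (r\<inverse>) x y = open_interval X r y x"
  by (auto simp: open_interval_def)

lemma full_left_converse: "full_left \<kappa> X r Y \<longleftrightarrow> full_right \<kappa> X (r\<inverse>) Y"
  by (simp add: full_left_def full_right_def open_interval_converse eq_commute)

lemma linear_order_on_subset_mem:
  assumes "linear_order_on X r" and "x \<in> X" and "y \<in> X" and "(x, y) \<notin> r"
  shows "(y, x) \<in> r \<and> x \<noteq> y"
  using assms unfolding order_on_defs by (metis refl_onD total_on_def)

text \<open>One inclusion suffices, since \<open>w\<close> is total and \<open>r\<close> is
  antisymmetric. This is how order types are computed below: \<open>r\<close> is compared on
  \<open>Y\<close> with a well-order of known type.\<close>

lemma Restr_eq_wellorder:
  assumes lin: "linear_order_on X r" and "Y \<subseteq> X" and "Well_order w" and "Y \<subseteq> Field w"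
    and sub: "\<And>x y. x \<in> Y \<Longrightarrow> y \<in> Y \<Longrightarrow> x \<noteq> y \<Longrightarrow> (x, y) \<in> w \<Longrightarrow> (x, y) \<in> r"
  shows "Restr r Y = Restr w Y"
proof -
  have "(x, y) \<in> r \<longleftrightarrow> (x, y) \<in> w" if "x \<in> Y" "y \<in> Y" for x y
  proof (cases "x = y")
    case True
    have "refl_on X r" "refl_on (Field w) w"
      using lin assms(3) by (auto simp: order_on_defs well_order_on_def)
    then show ?thesis
      using True that assms(2,4) by (auto dest: refl_onD)
  next
    case False
    have "(x, y) \<in> w \<or> (y, x) \<in> w"
      using False that assms(3,4) unfolding order_on_defs well_order_on_def total_on_def by blast
    moreover have "\<not> ((x, y) \<in> r \<and> (y, x) \<in> r)"
      using False lin unfolding order_on_defs antisym_def by blast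
    ultimately show ?thesis
      using sub[of x y] sub[of y x] False that by blast
  qed
  then show ?thesis by blast
qed

section \<open>Chains of length \<kappa> and small neighbourhoods\<close>

text \<open>The chain consists of the records of \<open>D\<close> along the initial well-order
  \<open>|D|\<close>. The two orders agree on records, and records are cofinal in \<open>D\<close>
  for \<open>r\<close>. Fewer than \<kappa> of them would cover \<open>D\<close> by fewer than
  \<kappa> small initial segments, against regularity.\<close>

lemma long_chain_if_small_initial_segments:
  assumes \<kappa>: "Card_order \<kappa>" "\<not> finite (Field \<kappa>)" "regularCard \<kappa>"
    and lin: "linear_order_on X r" and D: "D \<subseteq> X" "|D| =o \<kappa>"
    and small: "\<And>x. x \<in> D \<Longrightarrow> |{y \<in> D. (y, x) \<in> r}| <o \<kappa>"
  shows "\<exists>Y \<subseteq> D. has_order_type r Y \<kappa>"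
proof -
  let ?w = "|D|"
  \<comment> \<open>The records: points lying \<open>r\<close>-above everything that comes earlier
    in \<open>?w\<close>.\<close>
  define Y where "Y = {x \<in> D. \<forall>z \<in> D. (z, x) \<in> ?w \<and> z \<noteq> x \<longrightarrow> (z, x) \<in> r}"
  have W: "Well_order ?w" and F: "Field ?w = D"
    by (simp_all add: card_of_well_order_on Field_card_of)
  have wf: "wf (?w - Id)"
    using W by (simp add: well_order_on_def)
  have YD: "Y \<subseteq> D" by (auto simp: Y_def)
  have cover: "D \<subseteq> (\<Union>y \<in> Y. {x \<in> D. (x, y) \<in> r})"
  proof
    fix d assume d: "d \<in> D"
    let ?B = "{x \<in> D. (x, d) \<notin> r}"
    have "?B \<noteq> {}"
    proof
      assume "?B = {}"
      then have "{y \<in> D. (y, d) \<in> r} = D" by auto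
      then show False using small[OF d] D(2) not_ordLess_ordIso by force
    qed
    \<comment> \<open>The \<open>?w\<close>-first point not below \<open>d\<close> is a record:
      whatever precedes it is at most \<open>d\<close>, hence at most \<open>x\<close>.\<close>
    then obtain x where x: "x \<in> ?B" and min: "\<And>z. (z, x) \<in> ?w - Id \<Longrightarrow> z \<notin> ?B"
      using wf unfolding wf_eq_minimal by (metis (lifting) ex_in_conv)
    have dx: "(d, x) \<in> r"
      using linear_order_on_subset_mem[OF lin, of x d] x d D by auto
    have "(z, x) \<in> r" if "z \<in> D" "(z, x) \<in> ?w" "z \<noteq> x" for z
    proof -
      have "(z, d) \<in> r" using min[of z] that by auto
      with dx show ?thesis using lin unfolding order_on_defs trans_def by blast
    qed
    then have "x \<in> Y" using x by (auto simp: Y_def)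
    then show "d \<in> (\<Union>y \<in> Y. {x \<in> D. (x, y) \<in> r})" using d dx by auto
  qed
  have "\<not> |Y| <o \<kappa>"
  proof
    assume "|Y| <o \<kappa>"
    then have "|\<Union>y \<in> Y. {x \<in> D. (x, y) \<in> r}| <o \<kappa>"
      by (rule stable_UNION[OF regularCard_stable[OF \<kappa>]]) (use small YD in blast)
    then have "|D| <o \<kappa>"
      by (rule ordLeq_ordLess_trans[OF card_of_mono1[OF cover]])
    then show False using D(2) not_ordLess_ordIso by blast
  qed
  then have cY: "|Y| =o \<kappa>"
    using card_of_subset_cases[OF D(2) YD] by blast
  have "Restr r Y = Restr ?w Y"
    by (rule Restr_eq_wellorder[OF lin]) (use YD D W F in \<open>auto simp: Y_def\<close>)
  moreover have "Restr ?w Y =o \<kappa>"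
    using Restr_Card_order_ordIso[OF \<kappa>(1) D(2)] F YD cY by simp
  ultimately show ?thesis
    using YD by (auto simp: has_order_type_def)
qed

text \<open>The part of \<open>?D\<close> up to one of its points \<open>x\<close> lies in the small
  interval from \<open>z\<close> to \<open>x\<close> together with its endpoints. So if
  \<open>?D\<close> had size \<kappa>, the preceding lemma would give a chain of type \<kappa>. Left
  neighbourhoods are covered by applying this to the converse order.\<close>

lemma small_right_neighbourhood:
  assumes \<kappa>: "Card_order \<kappa>" "\<not> finite (Field \<kappa>)" "regularCard \<kappa>"
    and lin: "linear_order_on X r" and X: "|X| =o \<kappa>" and z: "z \<in> X"
    and none: "\<not> (\<exists>Y \<subseteq> X. has_order_type r Y \<kappa>)"
  shows "|{x \<in> X. (z, x) \<in> r \<and> |open_interval X r z x| <o \<kappa>}| <o \<kappa>"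
    (is "|?D| <o \<kappa>")
proof (rule ccontr)
  assume "\<not> |?D| <o \<kappa>"
  then have cD: "|?D| =o \<kappa>"
    using card_of_subset_cases[OF X, of ?D] by blast
  have "|{y \<in> ?D. (y, x) \<in> r}| <o \<kappa>" if "x \<in> ?D" for x
  proof -
    have "{y \<in> ?D. (y, x) \<in> r} \<subseteq> open_interval X r z x \<union> {z, x}"
      by (auto simp: open_interval_def)
    moreover have "|{z, x}| <o \<kappa>"
      by (rule finite_ordLess_Card_order[OF \<kappa>(1,2)]) simp
    then have "|open_interval X r z x \<union> {z, x}| <o \<kappa>"
      using \<kappa>(1,2) that card_of_Un_ordLess_infinite_Field by blast
    ultimately show ?thesis
      using card_of_mono1 ordLeq_ordLess_trans by blast
  qed
  then have "\<exists>Y \<subseteq> ?D. has_order_type r Y \<kappa>"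
    using long_chain_if_small_initial_segments[OF \<kappa> lin _ cD] by blast
  then show False using none by blast
qed

section \<open>Maximal pairwise sets and monotone subsets from the partition relation\<close>

text \<open>Zorn's lemma applies since any two points of the union of a chain lie in a common
  member. As \<open>P\<close> need not be symmetric, a point that cannot be added may fail
  \<open>P\<close> in either direction.\<close>

lemma maximal_pairwise_subset:
  obtains Z where "Z \<subseteq> X" and "pairwise P Z"
    and "\<And>x. x \<in> X \<Longrightarrow> x \<notin> Z \<Longrightarrow> \<exists>z \<in> Z. \<not> P z x \<or> \<not> P x z"
proof -
  let ?A = "{Z. Z \<subseteq> X \<and> pairwise P Z}"
  have "\<exists>M \<in> ?A. \<forall>Z \<in> ?A. M \<subseteq> Z \<longrightarrow> Z = M"
  proof (rule subset_Zorn')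
    fix C assume C: "subset.chain ?A C"
    have "P x y" if "A \<in> C" "B \<in> C" "x \<in> A" "y \<in> B" "x \<noteq> y" for x y A B
    proof -
      have "A \<subseteq> B \<or> B \<subseteq> A"
        using C that by (auto simp: subset_chain_def)
      moreover have "pairwise P A" "pairwise P B"
        using C that by (auto simp: subset_chain_def)
      ultimately show ?thesis
        using that by (auto simp: pairwise_def)
    qed
    then show "\<Union> C \<in> ?A"
      using C by (auto simp: subset_chain_def pairwise_def)
  qed
  then obtain M where M: "M \<subseteq> X" "pairwise P M"
    and max: "\<And>Z. Z \<subseteq> X \<Longrightarrow> pairwise P Z \<Longrightarrow> M \<subseteq> Z \<Longrightarrow> Z = M"
    by auto
  have "\<exists>z \<in> M. \<not> P z x \<or> \<not> P x z" if "x \<in> X" "x \<notin> M" for x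
  proof (rule ccontr)
    assume "\<not> (\<exists>z \<in> M. \<not> P z x \<or> \<not> P x z)"
    then have "pairwise P (insert x M)"
      using M by (auto simp: pairwise_insert)
    then show False using max[of "insert x M"] M that by blast
  qed
  with M that show ?thesis by blast
qed

text \<open>Copy \<mu> injectively into \<open>Z\<close> by \<open>g\<close> and colour a pair by
  whether \<open>g\<close> preserves its order. On a homogeneous set \<open>g\<close> is increasing
  or decreasing.\<close>

lemma partition_arrow_monotone_subset:
  assumes \<mu>: "Card_order \<mu>" "partition_arrow_2_2 \<mu>"
    and lin: "linear_order_on X r" and Z: "Z \<subseteq> X" "\<mu> \<le>o |Z|"
  shows "\<exists>Y \<subseteq> Z. has_order_type r Y \<mu> \<or> has_reverse_order_type r Y \<mu>"
proof -
  have "|Field \<mu>| \<le>o |Z|"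
    using Z(2) \<mu>(1) card_of_Field_ordIso ordIso_ordLeq_trans by blast
  then obtain g where g: "inj_on g (Field \<mu>)" "g ` Field \<mu> \<subseteq> Z"
    by (auto simp flip: card_of_ordLeq)
  \<comment> \<open>Quantifying over both arrangements of the pair makes this a property of the
    unordered set.\<close>
  let ?mono = "\<lambda>A. \<forall>x \<in> A. \<forall>y \<in> A. (x, y) \<in> \<mu> \<longrightarrow> (g x, g y) \<in> r"
  let ?f = "\<lambda>A. if ?mono A then 0 else 1 :: nat"
  have "?f \<in> [Field \<mu>]\<^bsup>2\<^esup> \<rightarrow> {..<2::nat}" by auto
  then obtain H i where H: "H \<subseteq> Field \<mu>" "|H| =o \<mu>" and i: "?f ` [H]\<^bsup>2\<^esup> \<subseteq> {i}"
    using \<mu>(2) unfolding partition_arrow_2_2_def by meson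
  \<comment> \<open>The well-order \<mu> transported along \<open>g\<close>, against which
    \<open>r\<close> and its converse can be compared.\<close>
  let ?w = "dir_image \<mu> g" and ?Y = "g ` H"
  have W\<mu>: "Well_order \<mu>" using \<mu>(1) by (simp add: card_order_on_def)
  have w\<mu>: "?w =o \<mu>"
    using dir_image_ordIso[OF W\<mu> g(1)] ordIso_symmetric by blast
  have W: "Well_order ?w"
    using Well_order_dir_image[OF W\<mu> g(1)] .
  have Yw: "?Y \<subseteq> Field ?w" using H(1) by (auto simp: dir_image_Field)
  have YZ: "?Y \<subseteq> Z" using H(1) g(2) by auto
  have YX: "?Y \<subseteq> X" using YZ Z(1) by auto
  have "bij_betw g H ?Y"
    using g(1) H(1) by (auto simp: bij_betw_def intro: inj_on_subset)
  then have "|?Y| =o |H|"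
    using card_of_ordIsoI ordIso_symmetric by blast
  then have cY: "|?Y| =o \<mu>" using H(2) ordIso_transitive by blast
  have type: "Restr ?w ?Y =o \<mu>"
    using Restr_Card_order_ordIso[OF \<mu>(1) w\<mu> Yw cY] .
  have pre: "\<exists>a \<in> H. \<exists>b \<in> H. x = g a \<and> y = g b \<and> (a, b) \<in> \<mu>"
    if xy: "x \<in> ?Y" "y \<in> ?Y" "(x, y) \<in> ?w" for x y
  proof -
    obtain a b where ab: "x = g a" "y = g b" "(a, b) \<in> \<mu>"
      using xy(3) unfolding dir_image_def by blast
    have "u \<in> H" if "u \<in> Field \<mu>" "g u \<in> ?Y" for u
      using that g(1) H(1) by (metis imageE inj_onD subsetD)
    then show ?thesis
      using ab xy(1,2) by (metis FieldI1 FieldI2)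
  qed
  show ?thesis
  proof (cases "\<forall>a \<in> H. \<forall>b \<in> H. a \<noteq> b \<longrightarrow> (a, b) \<in> \<mu> \<longrightarrow> (g a, g b) \<in> r")
    case True
    have "Restr r ?Y = Restr ?w ?Y"
    proof (rule Restr_eq_wellorder[OF lin YX W Yw])
      fix x y assume "x \<in> ?Y" "y \<in> ?Y" "x \<noteq> y" "(x, y) \<in> ?w"
      then show "(x, y) \<in> r" using pre[of x y] True by metis
    qed
    then show ?thesis
      using type YZ by (auto simp: has_order_type_def)
  next
    case False
    then obtain a b where ab: "a \<in> H" "b \<in> H" "a \<noteq> b" "(a, b) \<in> \<mu>" "(g a, g b) \<notin> r"
      by blast
    have "?f {a, b} \<in> {i}"
      using i ab by (intro subsetD[OF i] imageI) auto
    moreover have "?f {a, b} = 1" using ab by auto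
    \<comment> \<open>A single order failure fixes the colour, so every pair from \<open>H\<close>
      is one where \<open>g\<close> fails to be increasing.\<close>
    ultimately have i1: "i = 1" by simp
    have rev: "(g d, g c) \<in> r" if cd: "c \<in> H" "d \<in> H" "c \<noteq> d" "(c, d) \<in> \<mu>" for c d
    proof -
      have "?f {c, d} \<in> {i}"
        using cd by (intro subsetD[OF i] imageI) auto
      then have "?f {c, d} = 1" using i1 by (simp only: singleton_iff)
      \<comment> \<open>Some instance of \<open>?mono\<close> fails; reflexivity of \<open>r\<close>
        and antisymmetry of \<mu> leave only the instance from \<open>c\<close> to
        \<open>d\<close>.\<close>
      then have nm: "\<not> ?mono {c, d}" by (metis (mono_tags, lifting) zero_neq_one)
      have "antisym \<mu>"
        using W\<mu> by (simp add: well_order_on_def order_on_defs)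
      then have "(d, c) \<notin> \<mu>"
        using cd by (auto dest: antisymD)
      moreover have "(g c, g c) \<in> r" "(g d, g d) \<in> r"
        using lin cd YX unfolding order_on_defs by (auto dest: refl_onD)
      ultimately have "(g c, g d) \<notin> r" using nm by auto
      then show ?thesis
        using linear_order_on_subset_mem[OF lin] cd YX by blast
    qed
    have "linear_order_on X (r\<inverse>)" using lin by simp
    then have "Restr (r\<inverse>) ?Y = Restr ?w ?Y"
    proof (rule Restr_eq_wellorder[OF _ YX W Yw])
      fix x y assume "x \<in> ?Y" "y \<in> ?Y" "x \<noteq> y" "(x, y) \<in> ?w"
      then show "(x, y) \<in> r\<inverse>" using pre[of x y] rev by (metis converse_iff)
    qed
    then show ?thesis
      using type YZ by (auto simp: has_reverse_order_type_converse has_order_type_def)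
  qed
qed

section \<open>Fullness of separated sets and the theorem\<close>

text \<open>An infinite cardinal has no last element, so each \<open>y\<close> has a later
  \<open>y'\<close> in \<open>Y\<close>. The one interval between them already has size \<kappa>,
  and the union cannot exceed \<open>X\<close>.\<close>

lemma full_right_if_separated:
  assumes X: "|X| =o \<kappa>" and lin: "linear_order_on X r"
    and \<mu>: "Card_order \<mu>" "\<not> finite (Field \<mu>)"
    and Y: "Y \<subseteq> X" "has_order_type r Y \<mu>"
    and sep: "\<And>x y. x \<in> Y \<Longrightarrow> y \<in> Y \<Longrightarrow> x \<noteq> y \<Longrightarrow> (x, y) \<in> r \<Longrightarrow> \<not> |open_interval X r x y| <o \<kappa>"
  shows "full_right \<kappa> X r Y"
  unfolding full_right_def
proof
  fix y assume y: "y \<in> Y"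
  have R: "Restr r Y =o \<mu>" using Y(2) by (simp add: has_order_type_def)
  then have "Card_order (Restr r Y)" using \<mu>(1) Card_order_ordIso by blast
  moreover have "|Field (Restr r Y)| =o |Field \<mu>|" using R by (rule card_of_cong)
  then have "\<not> finite (Field (Restr r Y))" using \<mu>(2) card_of_ordIso_finite by blast
  moreover have "y \<in> Field (Restr r Y)"
    using y Y(1) lin unfolding order_on_defs Field_def by (auto dest: refl_onD)
  ultimately obtain y' where y': "y \<noteq> y'" "(y, y') \<in> Restr r Y"
    using infinite_Card_order_limit[of "Restr r Y" y] by metis
  let ?U = "\<Union>y' \<in> {y' \<in> Y. (y, y') \<in> r \<and> y \<noteq> y'}. open_interval X r y y'"
  have "open_interval X r y y' \<subseteq> ?U" using y' by auto
  then have "\<not> |?U| <o \<kappa>"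
    using sep[of y y'] y' ordLeq_ordLess_trans[OF card_of_mono1] by blast
  moreover have "?U \<subseteq> X" by (auto simp: open_interval_def)
  ultimately show "|?U| =o \<kappa>"
    using card_of_subset_cases[OF X] by blast
qed

theorem theorem4p6:
  fixes \<mu> :: "'m rel" and \<kappa> :: "'l rel" and X :: "'a set" and r :: "'a rel"
  assumes "weakly_compact \<mu>"
    and "Card_order \<kappa>" and "regularCard \<kappa>" and "\<mu> \<le>o \<kappa>"
    and "linear_order_on X r" and "|X| =o \<kappa>"
  shows "(\<exists>Y \<subseteq> X. full \<kappa> X r Y \<and> (has_order_type r Y \<mu> \<or> has_reverse_order_type r Y \<mu>))
       \<or> (\<exists>Y \<subseteq> X. has_order_type r Y \<kappa> \<or> has_reverse_order_type r Y \<kappa>)"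
proof (rule disjCI)
  assume "\<not> (\<exists>Y \<subseteq> X. has_order_type r Y \<kappa> \<or> has_reverse_order_type r Y \<kappa>)"
  \<comment> \<open>A reverse type for \<open>r\<close> is a type for the converse, so both sides of
    a point are handled by the same lemma.\<close>
  then have none: "\<not> (\<exists>Y \<subseteq> X. has_order_type r Y \<kappa>)" "\<not> (\<exists>Y \<subseteq> X. has_order_type (r\<inverse>) Y \<kappa>)"
    by (auto simp: has_reverse_order_type_converse)
  note \<kappa> = assms(2) and lin = assms(5) and X = assms(6)
  have lin': "linear_order_on X (r\<inverse>)" using lin by simp
  have \<mu>: "Card_order \<mu>" "natLeq <o \<mu>" "partition_arrow_2_2 \<mu>"
    using assms(1) by (auto simp: weakly_compact_def)
  have inf\<mu>: "\<not> finite (Field \<mu>)"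
    using cinfinite_mono[OF ordLess_imp_ordLeq[OF \<mu>(2)] natLeq_cinfinite]
    by (simp add: cinfinite_def)
  have inf\<kappa>: "\<not> finite (Field \<kappa>)"
    using cinfinite_mono[OF assms(4)] inf\<mu> by (auto simp: cinfinite_def)
  note \<kappa>3 = \<kappa> inf\<kappa> assms(3)
  \<comment> \<open>At least one of the two intervals is empty, so the disjunction says that
    \<kappa> points lie between \<open>x\<close> and \<open>y\<close>, whichever is smaller.\<close>
  let ?far = "\<lambda>x y. \<not> |open_interval X r x y| <o \<kappa> \<or> \<not> |open_interval X r y x| <o \<kappa>"
  obtain Z where Z: "Z \<subseteq> X" "pairwise ?far Z"
    and max: "\<And>x. x \<in> X \<Longrightarrow> x \<notin> Z \<Longrightarrow> \<exists>z \<in> Z. \<not> ?far z x \<or> \<not> ?far x z"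
    using maximal_pairwise_subset[of X ?far] by blast
  let ?R = "\<lambda>z. {x \<in> X. (z, x) \<in> r \<and> |open_interval X r z x| <o \<kappa>}"
  let ?L = "\<lambda>z. {x \<in> X. (z, x) \<in> r\<inverse> \<and> |open_interval X (r\<inverse>) z x| <o \<kappa>}"
  have "|?R z \<union> ?L z| <o \<kappa>" if "z \<in> Z" for z
    using that Z(1) small_right_neighbourhood[OF \<kappa>3 lin X _ none(1), of z]
      small_right_neighbourhood[OF \<kappa>3 lin' X _ none(2), of z]
      card_of_Un_ordLess_infinite_Field[OF inf\<kappa> \<kappa>] by blast
  \<comment> \<open>By maximality, a point outside \<open>Z\<close> is not far from some
    \<open>z\<close>, and so lies in the right or left neighbourhood of that
    \<open>z\<close>.\<close>
  moreover have cover: "X \<subseteq> (\<Union>z \<in> Z. ?R z \<union> ?L z \<union> {z})"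
  proof
    fix x assume x: "x \<in> X"
    show "x \<in> (\<Union>z \<in> Z. ?R z \<union> ?L z \<union> {z})"
    proof (cases "x \<in> Z")
      case False
      then obtain z where z: "z \<in> Z" "\<not> ?far z x"
        using max[OF x] by blast
      then have "(z, x) \<in> r \<or> (x, z) \<in> r"
        using linear_order_on_subset_mem[OF lin] x Z(1) by blast
      then show ?thesis
        using z x by (auto simp: open_interval_converse)
    qed auto
  qed
  moreover have "|{z}| <o \<kappa>" for z :: 'a
    by (rule finite_ordLess_Card_order[OF \<kappa> inf\<kappa>]) simp
  ultimately have small: "|?R z \<union> ?L z \<union> {z}| <o \<kappa>" if "z \<in> Z" for z
    using that card_of_Un_ordLess_infinite_Field[OF inf\<kappa> \<kappa>] by blast
  have "\<not> |Z| <o \<kappa>"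
  proof
    assume "|Z| <o \<kappa>"
    then have "|\<Union>z \<in> Z. ?R z \<union> ?L z \<union> {z}| <o \<kappa>"
      using small by (rule stable_UNION[OF regularCard_stable[OF \<kappa>3]])
    then have "|X| <o \<kappa>"
      by (rule ordLeq_ordLess_trans[OF card_of_mono1[OF cover]])
    then show False using X not_ordLess_ordIso by blast
  qed
  then have "|Z| =o \<kappa>"
    using card_of_subset_cases[OF X Z(1)] by blast
  then have "\<mu> \<le>o |Z|"
    using assms(4) ordIso_symmetric ordLeq_ordIso_trans by blast
  then obtain Y where Y: "Y \<subseteq> Z" "has_order_type r Y \<mu> \<or> has_reverse_order_type r Y \<mu>"
    using partition_arrow_monotone_subset[OF \<mu>(1,3) lin Z(1)] by blast
  \<comment> \<open>The interval in the wrong direction is empty, so for \<open>x\<close> below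
    \<open>y\<close> in \<open>Z\<close> farness is about the interval from \<open>x\<close> to
    \<open>y\<close>.\<close>
  have empty: "open_interval X r y x = {}" if "(x, y) \<in> r" for x y
    using that lin unfolding open_interval_def order_on_defs antisym_def trans_def by blast
  have sep: "\<not> |open_interval X r x y| <o \<kappa>" if "x \<in> Y" "y \<in> Y" "x \<noteq> y" "(x, y) \<in> r" for x y
  proof -
    have "|{} :: 'a set| <o \<kappa>"
      by (rule finite_ordLess_Card_order[OF \<kappa> inf\<kappa>]) simp
    then show ?thesis
      using Z(2) Y(1) that empty[OF that(4)] unfolding pairwise_def by force
  qed
  have YX: "Y \<subseteq> X" using Y(1) Z(1) by blast
  \<comment> \<open>Type \<mu> gives fullness on the right; the reverse type gives fullness on the
    left, through the converse order.\<close>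
  from Y(2) have "full \<kappa> X r Y"
  proof
    assume "has_order_type r Y \<mu>"
    then have "full_right \<kappa> X r Y"
      using full_right_if_separated[OF X lin \<mu>(1) inf\<mu> YX] sep by blast
    then show ?thesis by (simp add: full_def)
  next
    assume "has_reverse_order_type r Y \<mu>"
    then have "full_right \<kappa> X (r\<inverse>) Y"
      unfolding has_reverse_order_type_converse
      by (rule full_right_if_separated[OF X lin' \<mu>(1) inf\<mu> YX])
        (use sep in \<open>auto simp: open_interval_converse\<close>)
    then show ?thesis by (simp add: full_def full_left_converse)
  qed
  then show "\<exists>Y \<subseteq> X. full \<kappa> X r Y \<and> (has_order_type r Y \<mu> \<or> has_reverse_order_type r Y \<mu>)"
    using Y(2) YX by blast
qed

end
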